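(* Let $G$ be a connected graph (loops and multiple edges allowed) with vertex set $[n]=\{1,\dots,n\}$, let $m\in[n]$, and let $\tau\in S_n$ be a vertex ranking. Let $\mathcal{MP}_{G,m}$ be the set of $(G,m)$-multiparking functions and $\mathcal{F}_{G,m}$ the set of spanning color $m$-forests of $G$. Then the mapping $\Phi=\Phi_{G,m,\tau}$, which sends $f$ to the output $F_n$ of Algorithm A applied to $f$, is a bijection from $\mathcal{MP}_{G,m}$ to $\mathcal{F}_{G,m}$.
   Context: All graphs are finite. $\mathbb{N}$ includes $0$. For $i,j\in[n]$, $\mu_G(i,j)$ is the number of edges joining $i$ and $j$; these edges are given the distinct colors $0,1,\dots,\mu_G(i,j)-1$, and $\{i,j\}_k$ denotes the edge joining $i$ and $j$ of color $k$. For $I\subseteq[n]$ and $i\in I$, $\mathrm{outdeg}_I(i)$ is the number of edges of $G$ from $i$ to vertices outside $I$. For $I\subseteq[n]$, $\alpha(I,m)=\min\{i\in I: i\ge m\}$ (undefined if $I$ has no element $\geq m$). A $(G,m)$-multiparking function is a function $f:[n]\to\mathbb{N}\cup\{-1\}$ such that for every nonempty $I\subseteq[n]$ either (A) $\alpha(I,m)$ exists and $f(\alpha(I,m))=-1$, or (B) there is $i\in I$ with $0\le f(i)<\mathrm{outdeg}_I(i)$. A spanning color $m$-forest of $G$ is a spanning subgraph $F$ of $G$ (a set of colored edges of $G$ together with all vertices of $G$) without cycles such that every connected component of $F$ contains a vertex $j$ with $m\le j\le n$. Algorithm A (input: $f\in\mathcal{MP}_{G,m}$). Start with $val_0=f$,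 $P_0=\emptyset$, $Q_0=\{m\}$, and $F_0$ the graph with the single vertex $m$ and no edges. At time $i=1,\dots,n$: let $v$ be the element of $Q_{i-1}$ with $\tau(v)$ minimal. Let $N=\{w\notin P_{i-1}\cup Q_{i-1}: 0\le val_{i-1}(w)\le\mu_G(w,v)-1\}$ and $\hat N=\{w\notin P_{i-1}\cup Q_{i-1}: val_{i-1}(w)\ge\mu_G(w,v)\}$. Set $val_i(w)=val_{i-1}(w)-\mu_G(w,v)$ for $w\in\hat N$, and $val_i(u)=val_{i-1}(u)$ for all other vertices $u$. Set $P_i=P_{i-1}\cup\{v\}$. Set $Q_i=(Q_{i-1}\cup N)\setminus\{v\}$ if this is nonempty; otherwise, if $P_i\ne[n]$, set $Q_i=\{u\}$ with $u=\alpha([n]\setminus P_i,m)$, and if $P_i=[n]$ set $Q_i=\emptyset$. Let $F_i$ be the graph on the vertex set $P_i\cup Q_i$ whose edges are those of $F_{i-1}$ together with the edges $\{w,v\}_{val_{i-1}(w)}$ for $w\in N$. The output is $F_n$. *)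

theory Defs
  imports Main "HOL-Combinatorics.Permutations"
begin

text \<open>
  An edge is a pair (S, k) of its set S of end points and its colour k, so that
  \<open>{i,j}\<^sub>k\<close> is \<open>({i, j}, k)\<close> and a loop at \<open>i\<close> is \<open>({i}, k)\<close>.
\<close>

type_synonym edge = "nat set \<times> nat"

record cgraph =
  verts :: "nat set"
  edges :: "edge set"

definition mu :: "cgraph \<Rightarrow> nat \<Rightarrow> nat \<Rightarrow> nat" where
  "mu G i j = card {e \<in> edges G. fst e = {i, j}}"

text \<open>
  The last conjunct is the colouring convention: the edges joining \<open>i\<close> and \<open>j\<close> carry exactly the
  colours \<open>0, \<dots>, mu G i j - 1\<close>.
\<close>

definition graph_on :: "nat \<Rightarrow> cgraph \<Rightarrow> bool" where
  "graph_on n G \<longleftrightarrow>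
     verts G = {1..n} \<and> finite (edges G) \<and>
     (\<forall>e \<in> edges G. \<exists>i \<in> verts G. \<exists>j \<in> verts G. fst e = {i, j}) \<and>
     (\<forall>i \<in> verts G. \<forall>j \<in> verts G. {k. ({i, j}, k) \<in> edges G} = {..<mu G i j})"

definition adjacent :: "cgraph \<Rightarrow> nat \<Rightarrow> nat \<Rightarrow> bool" where
  "adjacent G u v \<longleftrightarrow> (\<exists>e \<in> edges G. fst e = {u, v})"

definition component_of :: "cgraph \<Rightarrow> nat \<Rightarrow> nat set" where
  "component_of G u = {v \<in> verts G. (adjacent G)\<^sup>*\<^sup>* u v}"

definition components :: "cgraph \<Rightarrow> nat set set" where
  "components G = component_of G ` verts G"

definition connected_graph :: "cgraph \<Rightarrow> bool" where
  "connected_graph G \<longleftrightarrow> verts G \<noteq> {} \<and> (\<forall>u \<in> verts G. \<forall>v \<in> verts G. (adjacent G)\<^sup>*\<^sup>* u v)"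

text \<open>
  The cycle passes through the distinct vertices \<open>vs\<close> cyclically, along the distinct edges \<open>es\<close>.
  Loops are cycles of length 1, and two parallel edges form a cycle of length 2.
\<close>

definition is_cycle :: "cgraph \<Rightarrow> nat list \<Rightarrow> edge list \<Rightarrow> bool" where
  "is_cycle G vs es \<longleftrightarrow>
     vs \<noteq> [] \<and> length es = length vs \<and> distinct vs \<and> distinct es \<and>
     set vs \<subseteq> verts G \<and> set es \<subseteq> edges G \<and>
     (\<forall>i < length vs. fst (es ! i) = {vs ! i, vs ! (Suc i mod length vs)})"

definition acyclic_graph :: "cgraph \<Rightarrow> bool" where
  "acyclic_graph G \<longleftrightarrow> (\<nexists>vs es. is_cycle G vs es)"

definition outdeg :: "cgraph \<Rightarrow> nat set \<Rightarrow> nat \<Rightarrow> nat" where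
  "outdeg G I i = card {e \<in> edges G. \<exists>j \<in> verts G - I. fst e = {i, j}}"

definition alpha :: "nat set \<Rightarrow> nat \<Rightarrow> nat option" where
  "alpha I m = (if \<exists>i \<in> I. m \<le> i then Some (LEAST i. i \<in> I \<and> m \<le> i) else None)"

definition multiparking :: "cgraph \<Rightarrow> nat \<Rightarrow> (nat \<Rightarrow> int) set" where
  "multiparking G m =
     {f \<in> verts G \<rightarrow>\<^sub>E {-1..}.
        \<forall>I \<subseteq> verts G. I \<noteq> {} \<longrightarrow>
          (\<exists>a. alpha I m = Some a \<and> f a = -1) \<or>
          (\<exists>i \<in> I. 0 \<le> f i \<and> f i < int (outdeg G I i))}"

definition spanning_forests :: "cgraph \<Rightarrow> nat \<Rightarrow> cgraph set" where
  "spanning_forests G m =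
     {F. verts F = verts G \<and> edges F \<subseteq> edges G \<and> acyclic_graph F \<and>
         (\<forall>C \<in> components F. \<exists>j \<in> C. m \<le> j)}"

record state =
  cur_val :: "nat \<Rightarrow> int"
  cur_P :: "nat set"
  cur_Q :: "nat set"
  cur_F :: cgraph

definition init_state :: "nat \<Rightarrow> (nat \<Rightarrow> int) \<Rightarrow> state" where
  "init_state m f =
     \<lparr>cur_val = f, cur_P = {}, cur_Q = {m}, cur_F = \<lparr>verts = {m}, edges = {}\<rparr>\<rparr>"

text \<open>
  For multiparking functions \<open>f\<close>, \<open>alpha\<close> is defined whenever the algorithm asks for it; otherwise
  the value of \<open>the\<close> below is unspecified.
\<close>

definition step :: "cgraph \<Rightarrow> nat \<Rightarrow> (nat \<Rightarrow> nat) \<Rightarrow> state \<Rightarrow> state" where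
  "step G m \<tau> s =
     (let val = cur_val s; P = cur_P s; Q = cur_Q s;
          v = arg_min_on \<tau> Q;
          N = {w \<in> verts G - (P \<union> Q). 0 \<le> val w \<and> val w \<le> int (mu G w v) - 1};
          N' = {w \<in> verts G - (P \<union> Q). val w \<ge> int (mu G w v)};
          val' = (\<lambda>w. if w \<in> N' then val w - int (mu G w v) else val w);
          P' = P \<union> {v};
          Q' = (if (Q \<union> N) - {v} \<noteq> {} then (Q \<union> N) - {v}
                else if P' \<noteq> verts G then {the (alpha (verts G - P') m)}
                else {});
          F' = \<lparr>verts = P' \<union> Q', edges = edges (cur_F s) \<union> {({w, v}, nat (val w)) | w. w \<in> N}\<rparr>
      in \<lparr>cur_val = val', cur_P = P', cur_Q = Q', cur_F = F'\<rparr>)"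

definition Phi :: "cgraph \<Rightarrow> nat \<Rightarrow> (nat \<Rightarrow> nat) \<Rightarrow> (nat \<Rightarrow> int) \<Rightarrow> cgraph" where
  "Phi G m \<tau> f = cur_F ((step G m \<tau> ^^ card (verts G)) (init_state m f))"

end

theory Submission
  imports Defs
begin

text \<open>
  Algorithm A is a search of the graph that visits one vertex at each time. Write \<open>load i w\<close> for the
  number of edges from \<open>w\<close> to the vertices visited before time \<open>i\<close>. While \<open>w\<close> with \<open>f w \<ge> 0\<close> is undiscovered, each
  visit of a vertex \<open>v\<close> lowers its value by the number of edges to \<open>v\<close>, so \<open>w\<close> is discovered at the
  time \<open>i\<close> with \<open>load i w \<le> f w < load (i + 1) w\<close>, and the colour of the edge chosen for it is
  \<open>f w - load i w\<close>. In these terms the algorithm no longer modifies \<open>f\<close>: it is a search in which only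
  the rule that selects the newly discovered vertices depends on \<open>f\<close>. The same search can be run with
  a forest \<open>F\<close> as its input, discovering the undiscovered \<open>F\<close>-neighbours of the visited vertex. The
  locale \<open>exploration\<close> covers both.

  The search needs a new root when all discovered vertices have been visited; let \<open>I\<close> be the set of
  the other vertices. If the search follows \<open>f\<close>, then every \<open>w\<close> in \<open>I\<close> with \<open>f w \<ge> 0\<close> has
  \<open>f w \<ge> load i w \<ge> outdeg I w\<close>, so alternative (B) fails for \<open>I\<close> and (A) provides a root with
  value -1 (\<open>restart_at_minus_one\<close>). If it follows \<open>F\<close>, then \<open>I\<close> is a union of components of \<open>F\<close>,
  each of which contains a vertex that is at least \<open>m\<close> (\<open>forest_exploration_exists\<close>). So the search
  visits every vertex once, and the edges from children to parents form a forest: on a cycle, the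
  vertex visited last would have two edges to parents (\<open>tree_acyclic\<close>).

  The map is injective because the search that follows \<open>f\<close> is the search that follows its own output:
  an edge of the output that leads from the visited vertex to an undiscovered one is an edge chosen at
  that moment. Two functions with the same output therefore have the same search, and
  \<open>f w = load i w + colour\<close> for every child \<open>w\<close> while roots have the value -1 (\<open>Phi_inj\<close>).

  Conversely, for a forest \<open>F\<close> take the search that follows \<open>F\<close> and let the same formula define \<open>f\<close>.
  Condition (A) or (B) holds for a set \<open>I\<close> at the vertex of \<open>I\<close> that is visited first, according to
  whether it is a root or a child (\<open>children_imp_multiparking\<close>). The search that follows \<open>f\<close> is again
  the given one. It finds every edge of \<open>F\<close>, because the vertices waiting in the queue are always joined
  by edges found already, so that any other edge between two of them would close a cycle
  (\<open>forest_eq_tree_edges\<close>).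
\<close>

section \<open>Restarting vertices, outdegrees and cycles\<close>

lemma alpha_eq_Some_iff:
  "alpha I m = Some a \<longleftrightarrow> a \<in> I \<and> m \<le> a \<and> (\<forall>i\<in>I. m \<le> i \<longrightarrow> a \<le> i)"
proof -
  let ?l = "LEAST i. i \<in> I \<and> m \<le> i"
  have "?l = a \<longleftrightarrow> a \<in> I \<and> m \<le> a \<and> (\<forall>i\<in>I. m \<le> i \<longrightarrow> a \<le> i)"
    if i: "i \<in> I \<and> m \<le> i" for i
  proof
    assume "?l = a"
    then show "a \<in> I \<and> m \<le> a \<and> (\<forall>i\<in>I. m \<le> i \<longrightarrow> a \<le> i)"
      using LeastI[of "\<lambda>i. i \<in> I \<and> m \<le> i", OF i] Least_le[of "\<lambda>i. i \<in> I \<and> m \<le> i"] by blast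
  qed (auto intro: Least_equality)
  then show ?thesis
    unfolding alpha_def by auto
qed

lemma alpha_eq_None_iff: "alpha I m = None \<longleftrightarrow> (\<forall>i\<in>I. i < m)"
  by (simp add: alpha_def) (meson leD leI)

lemma edge_colour_iff:
  assumes "graph_on n G" "i \<in> verts G" "j \<in> verts G"
  shows "({i, j}, k) \<in> edges G \<longleftrightarrow> k < mu G i j"
  using assms unfolding graph_on_def by blast

lemma outdeg_eq_sum_mu:
  assumes "graph_on n G"
  shows "outdeg G I i = (\<Sum>j\<in>verts G - I. mu G i j)"
proof -
  have fin: "finite (verts G)" "finite (edges G)"
    using assms by (auto simp: graph_on_def)
  have "{e \<in> edges G. \<exists>j \<in> verts G - I. fst e = {i, j}}
      = (\<Union>j\<in>verts G - I. {e \<in> edges G. fst e = {i, j}})"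
    by auto
  then show ?thesis
    unfolding outdeg_def mu_def using fin
    by (simp only:) (rule card_UN_disjoint; auto simp: doubleton_eq_iff)
qed

lemma rtranclp_imp_distinct_path:
  assumes "R\<^sup>*\<^sup>* a b"
  shows "\<exists>xs. xs \<noteq> [] \<and> distinct xs \<and> hd xs = a \<and> last xs = b \<and>
           (\<forall>i. Suc i < length xs \<longrightarrow> R (xs ! i) (xs ! Suc i))"
  using assms
proof (induction rule: rtranclp_induct)
  case base
  show ?case by (rule exI[of _ "[a]"]) simp
next
  case (step y z)
  then obtain xs where xs: "xs \<noteq> []" "distinct xs" "hd xs = a" "last xs = y"
    "\<And>i. Suc i < length xs \<Longrightarrow> R (xs ! i) (xs ! Suc i)" by blast
  show ?case
  proof (cases "z \<in> set xs")
    case True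
    then obtain k where k: "k < length xs" "xs ! k = z" by (auto simp: in_set_conv_nth)
    show ?thesis
    proof (rule exI[of _ "take (Suc k) xs"], intro conjI allI impI)
      show "last (take (Suc k) xs) = z"
        using k by (simp add: take_Suc_conv_app_nth)
    qed (use xs k in \<open>auto simp: hd_take\<close>)
  next
    case False
    show ?thesis
    proof (rule exI[of _ "xs @ [z]"], intro conjI allI impI)
      fix i assume i: "Suc i < length (xs @ [z])"
      show "R ((xs @ [z]) ! i) ((xs @ [z]) ! Suc i)"
      proof (cases "Suc i < length xs")
        case True
        then show ?thesis using xs(5) by (simp add: nth_append)
      next
        case False
        then have "i = length xs - 1" "Suc i = length xs" using i by auto
        then show ?thesis
          using xs step(2) by (simp add: nth_append last_conv_nth)
      qed
    qed (use xs False in auto)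
  qed
qed

text \<open>
  Loops (\<open>a = b\<close>, empty detour) and parallel edges (detour of length 1) are excluded as special cases.
  A simple path inside the detour, closed up by \<open>e\<close>, is the forbidden cycle.
\<close>

lemma acyclic_no_detour:
  assumes acyc: "acyclic_graph F"
    and e: "e \<in> edges F" "fst e = {a, b}"
    and ends: "\<And>e. e \<in> edges F \<Longrightarrow> fst e \<subseteq> verts F"
    and sub: "E \<subseteq> edges F - {e}"
    and path: "(\<lambda>x y. \<exists>e\<in>E. fst e = {x, y})\<^sup>*\<^sup>* a b"
  shows False
proof -
  obtain xs where xs: "xs \<noteq> []" "distinct xs" "hd xs = a" "last xs = b"
    and adj: "\<forall>i. Suc i < length xs \<longrightarrow> (\<exists>e\<in>E. fst e = {xs ! i, xs ! Suc i})"
    using rtranclp_imp_distinct_path[OF path] by auto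
  obtain g where g: "\<And>i. Suc i < length xs \<Longrightarrow> g i \<in> E \<and> fst (g i) = {xs ! i, xs ! Suc i}"
    using adj by metis
  define l where "l = length xs - 1"
  have len: "length xs = Suc l" using xs(1) by (simp add: l_def)
  have g: "i < l \<Longrightarrow> g i \<in> E \<and> fst (g i) = {xs ! i, xs ! Suc i}" for i
    using g len by simp
  define es where "es = map g [0..<l] @ [e]"
  have ends_ab: "xs ! 0 = a" "xs ! l = b"
    using xs len by (auto simp: hd_conv_nth last_conv_nth)
  have g_inj: "i = j" if "i < l" "j < l" "g i = g j" for i j
  proof -
    have "{xs ! i, xs ! Suc i} = {xs ! j, xs ! Suc j}"
      using g that by metis
    moreover have "xs ! p = xs ! q \<longleftrightarrow> p = q" if "p \<le> l" "q \<le> l" for p q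
      using nth_eq_iff_index_eq[OF xs(2)] that len by simp
    ultimately show ?thesis
      using that by (auto simp: doubleton_eq_iff)
  qed
  have "is_cycle F xs es"
    unfolding is_cycle_def
  proof (intro conjI allI impI)
    show "distinct es"
      using g sub g_inj by (fastforce simp: es_def distinct_map inj_on_def)
    show "set es \<subseteq> edges F"
      using g sub e by (fastforce simp: es_def)
    show "set xs \<subseteq> verts F"
    proof
      fix x assume "x \<in> set xs"
      then obtain i where i: "i < Suc l" "x = xs ! i" by (auto simp: in_set_conv_nth len)
      show "x \<in> verts F"
      proof (cases "i = l")
        case True
        then show ?thesis using i ends_ab ends[OF e(1)] e(2) by auto
      next
        case False
        then have "i < l" using i by simp
        then have "g i \<in> edges F" "x \<in> fst (g i)" using g sub i by auto
        then show ?thesis using ends by blast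
      qed
    qed
    show "fst (es ! i) = {xs ! i, xs ! (Suc i mod length xs)}" if i: "i < length xs" for i
    proof (cases "i = l")
      case True
      then show ?thesis using e(2) ends_ab len by (auto simp: es_def nth_append)
    next
      case False
      then show ?thesis using i g len by (simp add: es_def nth_append)
    qed
  qed (use xs len in \<open>auto simp: es_def\<close>)
  then show False using acyc by (auto simp: acyclic_graph_def)
qed

section \<open>Explorations\<close>

text \<open>
  \<open>P i\<close> and \<open>Q i\<close> are the visited vertices and the queue before the visit with number \<open>i\<close> (counted
  from 0), and \<open>N i\<close> is the set of vertices that this visit adds to the queue. The selection of
  \<open>N i\<close> is left open, so that it can follow a function or a forest.
\<close>

locale exploration =
  fixes G :: cgraph and m :: nat and \<tau> :: "nat \<Rightarrow> nat" and P Q N :: "nat \<Rightarrow> nat set"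
  assumes fin: "finite (verts G)" and m_in: "m \<in> verts G"
    and P_0: "P 0 = {}" and Q_0: "Q 0 = {m}"
    and N_sub: "i < card (verts G) \<Longrightarrow> N i \<subseteq> verts G - (P i \<union> Q i)"
    and P_Suc: "i < card (verts G) \<Longrightarrow> P (Suc i) = insert (arg_min_on \<tau> (Q i)) (P i)"
    and Q_Suc: "i < card (verts G) \<Longrightarrow> Q (Suc i) =
        (if Q i \<union> N i - {arg_min_on \<tau> (Q i)} \<noteq> {} then Q i \<union> N i - {arg_min_on \<tau> (Q i)}
         else if P (Suc i) \<noteq> verts G then {the (alpha (verts G - P (Suc i)) m)} else {})"
begin

abbreviation (input) "V \<equiv> verts G"
abbreviation (input) "n \<equiv> card (verts G)"

definition visit :: "nat \<Rightarrow> nat" where "visit i = arg_min_on \<tau> (Q i)"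

text \<open>
  This is a sum over times and not over the set \<open>P i\<close>, so that its recursion holds before it is known
  that no vertex is visited twice.
\<close>

definition load :: "nat \<Rightarrow> nat \<Rightarrow> nat" where "load i w = (\<Sum>j<i. mu G w (visit j))"

definition tree_edges :: "(nat \<Rightarrow> nat \<Rightarrow> nat) \<Rightarrow> nat \<Rightarrow> edge set" where
  "tree_edges col i = {({w, visit j}, col j w) | j w. j < i \<and> w \<in> N j}"

text \<open>
  No vertex discovered at an earlier time is still waiting. This holds exactly when a root has to be
  chosen, in particular at time 0, and at the end of the search.
\<close>

definition stalled :: "nat \<Rightarrow> bool" where
  "stalled j \<longleftrightarrow> (\<forall>i<j. P i \<union> Q i \<union> N i \<subseteq> P j)"

lemma load_Suc: "load (Suc i) w = load i w + mu G w (visit i)"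
  by (simp add: load_def)

lemma load_mono: "i \<le> j \<Longrightarrow> load i w \<le> load j w"
  unfolding load_def by (rule sum_mono2) auto

lemma P_image: "i \<le> n \<Longrightarrow> P i = visit ` {..<i}"
  by (induction i) (auto simp: P_0 P_Suc visit_def lessThan_Suc)

lemma discovered_Suc: "i < n \<Longrightarrow> P i \<union> Q i \<union> N i \<subseteq> P (Suc i) \<union> Q (Suc i)"
  by (subst P_Suc, assumption, subst Q_Suc, assumption) (simp split: if_split, blast)

lemma discovered_mono: "i \<le> j \<Longrightarrow> j \<le> n \<Longrightarrow> P i \<union> Q i \<subseteq> P j \<union> Q j"
proof (induction j rule: dec_induct)
  case (step k)
  then show ?case using discovered_Suc[of k] by auto
qed simp

lemma discovered_before: "i < j \<Longrightarrow> j \<le> n \<Longrightarrow> P i \<union> Q i \<union> N i \<subseteq> P j \<union> Q j"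
  using discovered_Suc[of i] discovered_mono[of "Suc i" j] by auto

lemma stalled_0: "stalled 0"
  by (simp add: stalled_def)

lemma stalled_Suc:
  assumes "i < n" "Q i \<union> N i - {visit i} = {}"
  shows "stalled (Suc i)"
proof -
  have "P i \<union> Q i \<union> N i \<subseteq> P (Suc i)"
    using assms P_Suc[of i] by (auto simp: visit_def)
  moreover have "P k \<union> Q k \<union> N k \<subseteq> P i \<union> Q i" if "k < i" for k
    using discovered_before[of k i] that assms by simp
  ultimately show ?thesis
    unfolding stalled_def less_Suc_eq by blast
qed

lemma P_neq_V_imp_Diff_nonempty:
  assumes "j \<le> n" "P j \<noteq> V"
  shows "V - P j \<noteq> {}"
proof
  assume "V - P j = {}"
  moreover have "card (P j) \<le> n" "finite (P j)"
    using P_image[OF assms(1)] assms(1) card_image_le[of "{..<j}" visit] by auto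
  ultimately show False
    using assms(2) card_seteq[of "P j" V] by auto
qed

lemma outdeg_unvisited_le_load:
  assumes "graph_on k G" "j \<le> n"
  shows "outdeg G (V - P j) w \<le> load j w"
proof -
  have "outdeg G (V - P j) w \<le> (\<Sum>u\<in>visit ` {..<j}. mu G w u)"
    unfolding outdeg_eq_sum_mu[OF assms(1)] using P_image[OF assms(2)]
    by (intro sum_mono2) auto
  also have "\<dots> \<le> load j w"
    unfolding load_def using sum_image_le[of "{..<j}" "mu G w" visit] by (simp add: o_def)
  finally show ?thesis .
qed

end

text \<open>
  The only freedom in a search is the choice of \<open>N i\<close>. The choices need to agree only under the
  assumption that the past agrees.
\<close>

lemma explorations_agree:
  assumes "exploration G m \<tau> P Q N" "exploration G m \<tau> P' Q' N'"
    and "\<And>i. i < card (verts G) \<Longrightarrow> (\<And>j. j \<le> i \<Longrightarrow> P j = P' j \<and> Q j = Q' j) \<Longrightarrow> N i = N' i"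
  shows "(\<forall>i\<le>card (verts G). P i = P' i \<and> Q i = Q' i) \<and> (\<forall>i<card (verts G). N i = N' i)"
proof -
  interpret A: exploration G m \<tau> P Q N by fact
  interpret B: exploration G m \<tau> P' Q' N' by fact
  have PQ: "P i = P' i \<and> Q i = Q' i" if "i \<le> card (verts G)" for i
    using that
  proof (induction i rule: less_induct)
    case (less i)
    show ?case
    proof (cases i)
      case 0
      then show ?thesis by (simp add: A.P_0 A.Q_0 B.P_0 B.Q_0)
    next
      case (Suc k)
      have eq: "P j = P' j \<and> Q j = Q' j" if "j \<le> k" for j
        using less that Suc by simp
      have k: "k < card (verts G)" using less.prems Suc by simp
      have "N k = N' k" using assms(3)[OF k] eq by blast
      then show ?thesis
        unfolding Suc A.Q_Suc[OF k] A.P_Suc[OF k] B.Q_Suc[OF k] B.P_Suc[OF k]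
        using eq[of k] by simp
    qed
  qed
  then show ?thesis using assms(3) by simp
qed

lemma exploration_exists:
  assumes "finite (verts G)" "m \<in> verts G"
    and nb: "\<And>p q. nb p q \<subseteq> verts G - (p \<union> q)"
  shows "\<exists>P Q. exploration G m \<tau> P Q (\<lambda>i. nb (P i) (Q i))"
proof -
  define next_PQ where "next_PQ pq =
    (let p = fst pq; q = snd pq; v = arg_min_on \<tau> q; q' = q \<union> nb p q - {v} in
      (insert v p, if q' \<noteq> {} then q' else if insert v p \<noteq> verts G
         then {the (alpha (verts G - insert v p) m)} else {}))" for pq
  define PQ where "PQ i = (next_PQ ^^ i) ({}, {m})" for i
  have S: "PQ (Suc i) = next_PQ (PQ i)" for i
    by (simp add: PQ_def)
  have "exploration G m \<tau> (fst \<circ> PQ) (snd \<circ> PQ) (\<lambda>i. nb ((fst \<circ> PQ) i) ((snd \<circ> PQ) i))"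
    by unfold_locales (use assms in \<open>simp_all add: S next_PQ_def Let_def\<close>, simp_all add: PQ_def)
  then show ?thesis by blast
qed

text \<open>
  With a root available at each stalled time, the value of \<open>the\<close> in the recursion for \<open>Q\<close> is never
  arbitrary, and the search reaches every vertex.
\<close>

locale complete_exploration = exploration +
  assumes restart: "stalled j \<Longrightarrow> j \<le> n \<Longrightarrow> P j \<noteq> V \<Longrightarrow> alpha (V - P j) m \<noteq> None"
begin

lemma invariant:
  "i \<le> n \<Longrightarrow> P i \<subseteq> V \<and> Q i \<subseteq> V \<and> P i \<inter> Q i = {} \<and> card (P i) = i \<and> (i < n \<longrightarrow> Q i \<noteq> {})"
proof (induction i)
  case 0
  then show ?case using m_in by (simp add: P_0 Q_0)
next
  case (Suc i)
  then have i: "i < n" and IH: "P i \<subseteq> V" "Q i \<subseteq> V" "P i \<inter> Q i = {}" "card (P i) = i" "Q i \<noteq> {}"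
    by auto
  have fins: "finite (P i)" "finite (Q i)" using IH fin by (auto intro: finite_subset)
  have v: "visit i \<in> Q i"
    unfolding visit_def using arg_min_if_finite(1) fins(2) IH(5) by blast
  have PS: "P (Suc i) = insert (visit i) (P i)" using P_Suc[OF i] by (simp add: visit_def)
  have card: "card (P (Suc i)) = Suc i" proof -
    have "visit i \<notin> P i" using v IH by blast
    then show ?thesis using PS IH(4) fins by simp
  qed
  have PV: "P (Suc i) \<subseteq> V" using PS v IH by auto
  have Q: "Q (Suc i) \<subseteq> V \<and> P (Suc i) \<inter> Q (Suc i) = {} \<and> (Suc i < n \<longrightarrow> Q (Suc i) \<noteq> {})"
  proof (cases "Q i \<union> N i - {visit i} = {}")
    case False
    then have "Q (Suc i) = Q i \<union> N i - {visit i}" using Q_Suc[OF i] by (simp add: visit_def)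
    then show ?thesis unfolding PS
      using False IH(1-3) N_sub[OF i] by (intro conjI) auto
  next
    case True
    show ?thesis
    proof (cases "P (Suc i) = V")
      case True
      have "Q (Suc i) = {}"
        unfolding Q_Suc[OF i, folded visit_def] using \<open>Q i \<union> N i - _ = {}\<close> True by (simp only: if_False if_True not_True_eq_False simp_thms)
      moreover have "Suc i = n" using True card by simp
      ultimately show ?thesis by simp
    next
      case False
      then obtain a where a: "alpha (V - P (Suc i)) m = Some a"
        using restart[OF stalled_Suc[OF i True]] i by auto
      have "Q (Suc i) = {a}"
        unfolding Q_Suc[OF i, folded visit_def] using True False a
        by (simp only: if_False if_True not_False_eq_True simp_thms option.sel)
      moreover have "a \<in> V - P (Suc i)" using a by (simp add: alpha_eq_Some_iff)
      ultimately show ?thesis by simp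
    qed
  qed
  then show ?case using card PV by (intro conjI) simp_all
qed

lemma visit_in_Q:
  assumes "i < n"
  shows "visit i \<in> Q i"
proof -
  have "Q i \<subseteq> V" "Q i \<noteq> {}" using invariant[of i] assms by auto
  then show ?thesis
    unfolding visit_def using arg_min_if_finite(1) finite_subset[OF _ fin] by blast
qed

lemma P_final: "P n = V"
  using invariant[of n] fin card_subset_eq by auto

lemma Q_final: "Q n = {}"
  using invariant[of n] P_final by auto

lemma visit_image: "visit ` {..<n} = V"
  using P_final P_image[of n] by simp

lemma visit_in_V: "i < n \<Longrightarrow> visit i \<in> V"
  using visit_image by blast

lemma visit_inj: "inj_on visit {..<n}"
  by (rule eq_card_imp_inj_on) (simp_all add: visit_image)

lemma visit_eq_iff: "i < n \<Longrightarrow> j < n \<Longrightarrow> visit i = visit j \<longleftrightarrow> i = j"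
  using visit_inj by (auto simp: inj_on_def)

lemma visit_in_P_iff: "i < n \<Longrightarrow> j \<le> n \<Longrightarrow> visit i \<in> P j \<longleftrightarrow> i < j"
  using P_image[of j] by (auto simp: image_iff visit_eq_iff)

lemma child_visited_later:
  assumes "i < n" "j < n" "visit j \<in> N i"
  shows "i < j"
proof -
  have "visit j \<notin> P i" "visit j \<noteq> visit i"
    using N_sub[OF assms(1)] assms visit_in_Q[OF assms(1)] by auto
  then show ?thesis
    using visit_in_P_iff[of j i] assms by (cases "i = j") auto
qed

lemma N_disjoint: "i < n \<Longrightarrow> j < n \<Longrightarrow> w \<in> N i \<Longrightarrow> w \<in> N j \<Longrightarrow> i = j"
proof (induction i j rule: linorder_wlog)
  case (le i j)
  then show ?case
    using discovered_before[of i j] N_sub[of j] by (cases "i = j") auto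
qed simp

lemma child_or_root:
  assumes "w \<in> V"
  shows "(\<exists>i<n. w \<in> N i) \<or>
    (\<exists>j<n. visit j = w \<and> stalled j \<and> alpha (V - P j) m = Some w)"
proof -
  have "(\<exists>j<i. w \<in> N j) \<or>
      (\<exists>j\<le>i. Q j = {w} \<and> stalled j \<and> alpha (V - P j) m = Some w)"
    if "i \<le> n" "w \<in> P i \<union> Q i" for i
    using that
  proof (induction i)
    case 0
    then have "w = m" by (simp add: P_0 Q_0)
    then show ?case using m_in by (auto simp: P_0 Q_0 stalled_0 alpha_eq_Some_iff)
  next
    case (Suc i)
    then have i: "i < n" by simp
    consider "w \<in> P i \<union> Q i" | "w \<in> N i" | "w \<in> Q (Suc i)" "w \<notin> Q i \<union> N i"
      using Suc.prems P_Suc[OF i] visit_in_Q[OF i] by (auto simp: visit_def)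
    then show ?case
    proof cases
      case 1
      then show ?thesis using Suc by (meson less_SucI le_SucI Suc_leD)
    next
      case 2
      then show ?thesis by blast
    next
      case 3
      then have e: "Q i \<union> N i - {visit i} = {}" "P (Suc i) \<noteq> V"
        "Q (Suc i) = {the (alpha (V - P (Suc i)) m)}"
        using Q_Suc[OF i] by (auto simp: visit_def split: if_splits)
      have st: "stalled (Suc i)" by (rule stalled_Suc[OF i e(1)])
      obtain a where a: "alpha (V - P (Suc i)) m = Some a"
        using restart[OF st _ e(2)] i by auto
      then show ?thesis using st e(3) 3(1) by auto
    qed
  qed
  from this[of n] consider "\<exists>j<n. w \<in> N j" |
      j where "j \<le> n" "Q j = {w}" "stalled j" "alpha (V - P j) m = Some w"
    using assms P_final by auto
  then show ?thesis
  proof cases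
    case 1
    then show ?thesis by (rule disjI1)
  next
    case 2
    then have "j < n" using Q_final by (cases "j = n") auto
    moreover from this have "visit j = w" using visit_in_Q[of j] 2(2) by simp
    ultimately show ?thesis using 2 by blast
  qed
qed

text \<open>
  An edge joins a child to a parent visited earlier. As \<open>visit i\<close> is visited before \<open>w\<close>, it must be the
  parent. This is why a search can be read off from its final set of edges.
\<close>

lemma tree_edge_to_undiscovered:
  assumes "i < n" "w \<in> V - (P i \<union> Q i)"
  shows "({w, visit i}, c) \<in> tree_edges col n \<longleftrightarrow> w \<in> N i \<and> c = col i w"
proof
  assume "({w, visit i}, c) \<in> tree_edges col n"
  then obtain j w' where j: "j < n" "w' \<in> N j" "c = col j w'" "{w, visit i} = {w', visit j}"
    by (auto simp: tree_edges_def)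
  obtain k where k: "k < n" "w = visit k" using assms visit_image by auto
  have "\<not> k < i" "k \<noteq> i"
    using assms k visit_in_P_iff[of k i] visit_in_Q[of i] by auto
  then have "i < k" by simp
  have "w' \<noteq> visit i" if "visit j = w"
  proof
    assume "w' = visit i"
    then have "j < i" using child_visited_later[of j i] j assms(1) by blast
    moreover have "j = k" using that j k visit_eq_iff by blast
    ultimately show False using \<open>i < k\<close> by simp
  qed
  then have "w' = w" "visit j = visit i" using j(4) by (auto simp: doubleton_eq_iff)
  moreover from this have "j = i" using j visit_eq_iff assms(1) by blast
  ultimately show "w \<in> N i \<and> c = col i w" using j by blast
qed (use assms in \<open>auto simp: tree_edges_def\<close>)

text \<open>
  Of the vertices of a cycle, let \<open>x\<close> be visited last. Both cycle edges at \<open>x\<close> lead to its parent,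
  hence they are the same edge and the cycle is a loop; but the parent of \<open>x\<close> is not \<open>x\<close>.
\<close>

lemma tree_acyclic:
  assumes "edges F = tree_edges col n" "verts F = V"
  shows "acyclic_graph F"
  unfolding acyclic_graph_def
proof safe
  fix vs es
  assume cyc: "is_cycle F vs es"
  let ?l = "length vs"
  have l: "0 < ?l" "length es = ?l" "distinct vs" "distinct es" "set vs \<subseteq> V"
    and es: "\<And>i. i < ?l \<Longrightarrow> es ! i \<in> tree_edges col n"
    and fe: "\<And>i. i < ?l \<Longrightarrow> fst (es ! i) = {vs ! i, vs ! (Suc i mod ?l)}"
    using cyc assms by (auto simp: is_cycle_def)
  define time where "time = inv_into {..<n} visit"
  have time: "time w < n" "visit (time w) = w" if "w \<in> V" for w
    using that visit_image inv_into_into[of w visit "{..<n}"] f_inv_into_f[of w visit "{..<n}"]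
    by (auto simp: time_def)
  have "finite (time ` set vs)" "time ` set vs \<noteq> {}" using l(1) by auto
  then have "Max (time ` set vs) \<in> time ` set vs" by (rule Max_in)
  then obtain x where x: "x \<in> set vs" "time x = Max (time ` set vs)" by auto
  have xmax: "time y \<le> time x" if "y \<in> set vs" for y using that x by auto
  obtain p where p: "p < ?l" "vs ! p = x" using x by (auto simp: in_set_conv_nth)
  have parent: "\<exists>i<n. x \<in> N i \<and> y \<noteq> x \<and> e = ({x, visit i}, col i x)"
    if e: "e \<in> tree_edges col n" "fst e = {x, y}" "y \<in> set vs" for e y
  proof -
    obtain i w where i: "i < n" "w \<in> N i" "e = ({w, visit i}, col i w)"
      using e by (auto simp: tree_edges_def)
    have wV: "w \<in> V" using i N_sub by blast
    have "i < time w" using child_visited_later[of i "time w"] i time[OF wV] by simp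
    moreover have "time (visit i) = i"
      using time[of "visit i"] visit_image i visit_eq_iff by auto
    moreover have "w \<in> set vs" using e i x by (auto simp: doubleton_eq_iff)
    ultimately have "w \<noteq> visit i" "visit i \<noteq> x" using xmax[of w] by auto
    then have "w = x" "visit i = y" using i e by (auto simp: doubleton_eq_iff)
    then show ?thesis using i \<open>visit i \<noteq> x\<close> by auto
  qed
  \<comment> \<open>the edge that enters \<open>x\<close> on the cycle\<close>
  define q where "q = (if p = 0 then ?l - 1 else p - 1)"
  have q: "q < ?l" "Suc q mod ?l = p" using p l(1) by (auto simp: q_def)
  have "Suc p mod ?l < ?l" using l(1) by simp
  then have 1: "\<exists>i<n. x \<in> N i \<and> vs ! (Suc p mod ?l) \<noteq> x \<and> es ! p = ({x, visit i}, col i x)"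
    using parent[OF es[OF p(1)]] fe[OF p(1)] p by simp
  have 2: "\<exists>i<n. x \<in> N i \<and> vs ! q \<noteq> x \<and> es ! q = ({x, visit i}, col i x)"
    using parent[OF es[OF q(1)]] fe[OF q(1)] p q by (simp add: insert_commute)
  obtain i j where ij: "i < n" "x \<in> N i" "es ! p = ({x, visit i}, col i x)"
    "j < n" "x \<in> N j" "es ! q = ({x, visit j}, col j x)" using 1 2 by blast
  moreover have "i = j" using N_disjoint ij by blast
  ultimately have "es ! p = es ! q" by simp
  then have "p = q" using l p q by (simp add: nth_eq_iff_index_eq)
  then show False using 2 p by simp
qed

lemma tree_reaches_root:
  assumes F: "edges F = tree_edges col n" "verts F = V" and "w \<in> V"
  shows "\<exists>r\<in>V. m \<le> r \<and> (adjacent F)\<^sup>*\<^sup>* w r"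
proof -
  have "\<exists>r\<in>V. m \<le> r \<and> (adjacent F)\<^sup>*\<^sup>* (visit k) r" if "k < n" for k
    using that
  proof (induction k rule: less_induct)
    case (less k)
    have kV: "visit k \<in> V" using visit_in_V less.prems by blast
    from child_or_root[OF this] show ?case
    proof
      assume "\<exists>i<n. visit k \<in> N i"
      then obtain i where i: "i < n" "visit k \<in> N i" by blast
      have "i < k" using child_visited_later i less.prems by blast
      then obtain r where r: "r \<in> V" "m \<le> r" "(adjacent F)\<^sup>*\<^sup>* (visit i) r"
        using less by auto
      have "adjacent F (visit k) (visit i)"
        using i F by (force simp: adjacent_def tree_edges_def)
      then show ?thesis using r converse_rtranclp_into_rtranclp[of "adjacent F"] by blast
    next
      assume "\<exists>j<n. visit j = visit k \<and> stalled j \<and> alpha (V - P j) m = Some (visit k)"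
      then have "m \<le> visit k" by (auto simp: alpha_eq_Some_iff)
      then show ?thesis using kV by blast
    qed
  qed
  moreover obtain k where "k < n" "w = visit k" using assms(3) visit_image by auto
  ultimately show ?thesis by blast
qed

text \<open>
  All waiting vertices belong to the component that is being searched: each new child is joined to the
  visited vertex, and a new root waits alone.
\<close>

lemma tree_connects_queue:
  assumes "i \<le> n" "a \<in> Q i" "b \<in> Q i"
  shows "(\<lambda>x y. \<exists>e\<in>tree_edges col i. fst e = {x, y})\<^sup>*\<^sup>* a b"
  using assms
proof (induction i arbitrary: a b)
  case 0
  then show ?case by (simp add: Q_0)
next
  case (Suc i)
  let ?R = "\<lambda>i x y. \<exists>e\<in>tree_edges col i. fst e = {x, y}"
  have i: "i < n" using Suc by simp
  have "tree_edges col i \<subseteq> tree_edges col (Suc i)"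
    unfolding tree_edges_def using less_SucI by blast
  then have "?R i \<le> ?R (Suc i)" by blast
  then have mono: "(?R (Suc i))\<^sup>*\<^sup>* x y" if "(?R i)\<^sup>*\<^sup>* x y" for x y
    using that rtranclp_mono[of "?R i" "?R (Suc i)"] by blast
  have "symp (?R (Suc i))"
    by (simp add: symp_def insert_commute)
  then have "symp (?R (Suc i))\<^sup>*\<^sup>*" by (rule symp_rtranclp)
  then have sym: "(?R (Suc i))\<^sup>*\<^sup>* x y" if "(?R (Suc i))\<^sup>*\<^sup>* y x" for x y
    using that by (rule sympD)
  have to_v: "(?R (Suc i))\<^sup>*\<^sup>* x (visit i)" if x: "x \<in> Q i \<union> N i" for x
  proof (cases "x \<in> Q i")
    case True
    then show ?thesis using mono Suc.IH[of x "visit i"] visit_in_Q[OF i] i by simp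
  next
    case False
    then have "?R (Suc i) x (visit i)" using x by (force simp: tree_edges_def)
    then show ?thesis by blast
  qed
  show ?case
  proof (cases "Q i \<union> N i - {visit i} = {}")
    case True
    then have "a = b" using Suc.prems Q_Suc[OF i] by (auto simp: visit_def split: if_splits)
    then show ?thesis by simp
  next
    case False
    then have "a \<in> Q i \<union> N i" "b \<in> Q i \<union> N i"
      using Suc.prems Q_Suc[OF i] by (auto simp: visit_def)
    then show ?thesis using rtranclp_trans[OF to_v sym[OF to_v]] by blast
  qed
qed

text \<open>
  For fixed \<open>w\<close> the intervals from \<open>load i w\<close> to \<open>load (Suc i) w\<close> are disjoint, so \<open>f w\<close> determines the
  time at which \<open>w\<close> is discovered.
\<close>

lemma children_satisfy_parking_rule:
  fixes f :: "nat \<Rightarrow> int"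
  assumes child: "\<And>i w. i < n \<Longrightarrow> w \<in> N i \<Longrightarrow> int (load i w) \<le> f w \<and> f w < int (load (Suc i) w)"
    and other: "\<And>w. w \<in> V \<Longrightarrow> (\<And>i. i < n \<Longrightarrow> w \<notin> N i) \<Longrightarrow> f w = -1"
    and i: "i < n"
  shows "N i = {w \<in> V - (P i \<union> Q i). int (load i w) \<le> f w \<and> f w < int (load (Suc i) w)}"
proof (intro subset_antisym subsetI)
  fix w assume "w \<in> {w \<in> V - (P i \<union> Q i). int (load i w) \<le> f w \<and> f w < int (load (Suc i) w)}"
  then have w: "w \<in> V" "int (load i w) \<le> f w" "f w < int (load (Suc i) w)" by auto
  then obtain j where j: "j < n" "w \<in> N j" using other[of w] by fastforce
  have "\<not> i < j" "\<not> j < i"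
    using w child[OF j] load_mono[of "Suc i" j w] load_mono[of "Suc j" i w] by auto
  then have "i = j" by simp
  then show "w \<in> N i" using j by simp
qed (use N_sub[OF i] child[OF i] in auto)

text \<open>
  The witness for a set \<open>I\<close> is its vertex \<open>visit t\<close> that is visited first. If it was discovered at time
  \<open>i < t\<close>, then all vertices visited up to time \<open>i\<close> lie outside \<open>I\<close>, so that
  \<open>load (Suc i) (visit t) \<le> outdeg G I (visit t)\<close>. If it is a root, it is the least candidate
  among all unvisited vertices, and these include \<open>I\<close>.
\<close>

lemma children_imp_multiparking:
  assumes G: "graph_on k G"
    and dom: "f \<in> V \<rightarrow>\<^sub>E {-1..}"
    and child: "\<And>i w. i < n \<Longrightarrow> w \<in> N i \<Longrightarrow> int (load i w) \<le> f w \<and> f w < int (load (Suc i) w)"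
    and other: "\<And>w. w \<in> V \<Longrightarrow> (\<And>i. i < n \<Longrightarrow> w \<notin> N i) \<Longrightarrow> f w = -1"
  shows "f \<in> multiparking G m"
  unfolding multiparking_def
proof (intro CollectI conjI allI impI)
  fix I assume I: "I \<subseteq> V" "I \<noteq> {}"
  define t where "t = (LEAST t. t < n \<and> visit t \<in> I)"
  obtain w where "w \<in> I" "w \<in> visit ` {..<n}" using I visit_image by blast
  then have "\<exists>t. t < n \<and> visit t \<in> I" by auto
  from LeastI_ex[OF this] have t: "t < n" "visit t \<in> I" by (simp_all flip: t_def)
  have before: "visit j \<notin> I" if "j < t" for j
    using not_less_Least[of j "\<lambda>t. t < n \<and> visit t \<in> I"] that t(1) unfolding t_def[symmetric] by simp
  have inV: "visit t \<in> V" using t I by blast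
  show "(\<exists>a. alpha I m = Some a \<and> f a = -1) \<or> (\<exists>i\<in>I. 0 \<le> f i \<and> f i < int (outdeg G I i))"
  proof (cases "\<exists>i<n. visit t \<in> N i")
    case True
    then obtain i where i: "i < n" "visit t \<in> N i" by blast
    have "i < t" using child_visited_later i t by blast
    have "load (Suc i) (visit t) = (\<Sum>u\<in>visit ` {..<Suc i}. mu G (visit t) u)"
      proof -
      have "inj_on visit {..<Suc i}" using i by (intro inj_on_subset[OF visit_inj]) auto
      then show ?thesis by (simp add: load_def sum.reindex)
    qed
    also have "\<dots> \<le> outdeg G I (visit t)"
      unfolding outdeg_eq_sum_mu[OF G]
    proof (rule sum_mono2)
      show "visit ` {..<Suc i} \<subseteq> V - I"
      proof (rule image_subsetI)
        fix j assume "j \<in> {..<Suc i}"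
        then have "j < t" "j < n" using \<open>i < t\<close> t(1) by auto
        then show "visit j \<in> V - I" using before visit_in_V by blast
      qed
    qed (use fin in auto)
    finally show ?thesis using child[OF i] t by (intro disjI2 bexI[of _ "visit t"]) auto
  next
    case False
    then obtain j where j: "j < n" "visit j = visit t" "alpha (V - P j) m = Some (visit t)"
      using child_or_root[OF inV] by blast
    have "j = t" using j t visit_eq_iff by blast
    have "I \<subseteq> V - P t"
      using I before P_image[of t] t by auto
    then have "alpha I m = Some (visit t)"
      using j t unfolding \<open>j = t\<close> alpha_eq_Some_iff by blast
    moreover have "f (visit t) = -1" using other[OF inV] False by blast
    ultimately show ?thesis by blast
  qed
qed (use dom in simp)

end

section \<open>Explorations directed by a function\<close>

locale parking_exploration = exploration +
  fixes f :: "nat \<Rightarrow> int"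
  assumes N_parking: "i < n \<Longrightarrow>
    N i = {w \<in> V - (P i \<union> Q i). int (load i w) \<le> f w \<and> f w < int (load (Suc i) w)}"
begin

lemma load_le_value:
  assumes "w \<in> V" "0 \<le> f w" "i \<le> n" "\<And>j. j < i \<Longrightarrow> w \<notin> P j \<union> Q j \<union> N j"
  shows "int (load i w) \<le> f w"
  using assms(3,4)
proof (induction i)
  case 0
  then show ?case using assms(2) by (simp add: load_def)
next
  case (Suc i)
  then have IH: "int (load i w) \<le> f w" and w: "w \<notin> P i \<union> Q i \<union> N i" and i: "i < n" by auto
  from w have "\<not> f w < int (load (Suc i) w)"
    unfolding N_parking[OF i] using IH assms(1) by blast
  then show ?case by simp
qed

text \<open>
  No unvisited vertex has been discovered, so its value is -1 or at least its load, which bounds its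
  out-degree. This refutes alternative (B) for the set of unvisited vertices.
\<close>

lemma restart_at_minus_one:
  assumes G: "graph_on k G" and f: "f \<in> multiparking G m"
    and st: "stalled j" "j \<le> n" "P j \<noteq> V"
  shows "\<exists>a. alpha (V - P j) m = Some a \<and> f a = -1"
proof -
  have "V - P j \<noteq> {}" using P_neq_V_imp_Diff_nonempty st by blast
  then consider "\<exists>a. alpha (V - P j) m = Some a \<and> f a = -1" |
      w where "w \<in> V - P j" "0 \<le> f w" "f w < int (outdeg G (V - P j) w)"
    using f unfolding multiparking_def by blast
  then show ?thesis
  proof cases
    case 2
    have "int (load j w) \<le> f w"
      using 2 st by (intro load_le_value) (auto simp: stalled_def)
    then show ?thesis using 2 outdeg_unvisited_le_load[OF G st(2), of w] by linarith
  qed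
qed

end

lemma parking_explorations_agree:
  assumes "parking_exploration G m \<tau> P Q N f" "parking_exploration G m \<tau> P' Q' N' f"
  shows "(\<forall>i\<le>card (verts G). P i = P' i \<and> Q i = Q' i) \<and> (\<forall>i<card (verts G). N i = N' i)"
proof -
  interpret A: parking_exploration G m \<tau> P Q N f by fact
  interpret B: parking_exploration G m \<tau> P' Q' N' f by fact
  show ?thesis
  proof (rule explorations_agree)
    fix i assume i: "i < card (verts G)" and eq: "\<And>j. j \<le> i \<Longrightarrow> P j = P' j \<and> Q j = Q' j"
    have "A.visit j = B.visit j" if "j \<le> i" for j
      using eq that by (simp add: A.visit_def B.visit_def)
    then have "A.load i w = B.load i w" "A.load (Suc i) w = B.load (Suc i) w" for w
      by (simp_all add: A.load_def B.load_def)
    then show "N i = N' i" using A.N_parking[OF i] B.N_parking[OF i] eq[of i] by simp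
  qed unfold_locales
qed

text \<open>
  The current value of an undiscovered vertex \<open>w\<close> is \<open>f w - load i w\<close>, unless \<open>f w\<close> is negative and
  is never changed. This turns the test of the algorithm into the interval test of the locale.
\<close>

lemma Phi_parking_exploration:
  assumes "finite (verts G)" "m \<in> verts G"
  obtains P Q N where "parking_exploration G m \<tau> P Q N f"
    "edges (Phi G m \<tau> f) = exploration.tree_edges \<tau> Q N
        (\<lambda>j w. nat (f w - int (exploration.load G \<tau> Q j w))) (card (verts G))"
    "verts (Phi G m \<tau> f) = P (card (verts G)) \<union> Q (card (verts G))"
proof -
  define s where "s i = (step G m \<tau> ^^ i) (init_state m f)" for i
  define P where "P i = cur_P (s i)" for i
  define Q where "Q i = cur_Q (s i)" for i
  define val where "val i = cur_val (s i)" for i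
  define v where "v i = arg_min_on \<tau> (Q i)" for i
  define N where "N i = {w \<in> verts G - (P i \<union> Q i). 0 \<le> val i w \<and> val i w \<le> int (mu G w (v i)) - 1}" for i
  have s0: "s 0 = init_state m f" and sS: "s (Suc i) = step G m \<tau> (s i)" for i
    by (simp_all add: s_def)
  have stepP: "P (Suc i) = insert (v i) (P i)" for i
    by (simp add: P_def sS step_def Let_def v_def Q_def)
  have stepQ: "Q (Suc i) = (if (Q i \<union> N i) - {v i} \<noteq> {} then (Q i \<union> N i) - {v i}
      else if P (Suc i) \<noteq> verts G then {the (alpha (verts G - P (Suc i)) m)} else {})" for i
    unfolding stepP N_def val_def v_def P_def Q_def by (simp add: sS step_def Let_def)
  have stepval: "val (Suc i) w = (if w \<in> verts G - (P i \<union> Q i) \<and> val i w \<ge> int (mu G w (v i))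
      then val i w - int (mu G w (v i)) else val i w)" for i w
    by (simp add: val_def sS step_def Let_def v_def Q_def P_def)
  have stepF: "edges (cur_F (s (Suc i))) =
      edges (cur_F (s i)) \<union> {({w, v i}, nat (val i w)) | w. w \<in> N i}" for i
    unfolding N_def val_def v_def P_def Q_def by (simp add: sS step_def Let_def)
  have vertsF: "verts (cur_F (s i)) = P i \<union> Q i" for i
    by (cases i) (simp_all add: s0 sS P_def Q_def init_state_def step_def Let_def)
  interpret exploration G m \<tau> P Q N
    by unfold_locales (use assms stepP stepQ in \<open>auto simp: P_def Q_def s0 init_state_def N_def v_def\<close>)
  have v: "v i = visit i" for i by (simp add: v_def visit_def)
  have val: "val i w = (if f w < 0 then f w else f w - int (load i w)) \<and>
      (0 \<le> f w \<longrightarrow> int (load i w) \<le> f w)"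
    if "i \<le> card (verts G)" "w \<in> verts G - (P i \<union> Q i)" for i w
    using that
  proof (induction i)
    case 0
    then show ?case by (simp add: val_def s0 init_state_def load_def)
  next
    case (Suc i)
    then have w: "w \<in> verts G - (P i \<union> Q i)" "w \<notin> N i" using discovered_Suc[of i] by auto
    then have IH: "val i w = (if f w < 0 then f w else f w - int (load i w))"
      "0 \<le> f w \<Longrightarrow> int (load i w) \<le> f w" using Suc by auto
    show ?case
    proof (cases "f w < 0")
      case True
      then show ?thesis using IH by (simp add: stepval)
    next
      case False
      then have "int (mu G w (v i)) \<le> val i w" using w IH by (auto simp: N_def)
      then show ?thesis using False w IH by (simp add: stepval load_Suc v)
    qed
  qed
  have "parking_exploration G m \<tau> P Q N f"
  proof unfold_locales
    fix i assume i: "i < card (verts G)"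
    have "0 \<le> val i w \<and> val i w \<le> int (mu G w (v i)) - 1 \<longleftrightarrow>
        int (load i w) \<le> f w \<and> f w < int (load (Suc i) w)" if "w \<in> verts G - (P i \<union> Q i)" for w
      using val[of i w] i that by (auto simp: load_Suc v)
    then show "N i = {w \<in> verts G - (P i \<union> Q i). int (load i w) \<le> f w \<and> f w < int (load (Suc i) w)}"
      unfolding N_def by blast
  qed
  moreover have "edges (cur_F (s i)) = tree_edges (\<lambda>j w. nat (f w - int (load j w))) i"
    if "i \<le> card (verts G)" for i
    using that
  proof (induction i)
    case 0
    then show ?case by (simp add: s0 init_state_def tree_edges_def)
  next
    case (Suc i)
    have "val i w = f w - int (load i w)" if "w \<in> N i" for w
    proof -
      have "w \<in> verts G - (P i \<union> Q i)" "0 \<le> val i w" using that by (auto simp: N_def)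
      then show ?thesis using val[of i w] Suc.prems by (auto split: if_splits)
    qed
    then have "{({w, v i}, nat (val i w)) | w. w \<in> N i} =
        {({w, visit i}, nat (f w - int (load i w))) | w. w \<in> N i}"
      unfolding v by (intro Collect_cong) metis
    moreover have "tree_edges c (Suc i) = tree_edges c i \<union> {({w, visit i}, c i w) | w. w \<in> N i}" for c
      unfolding tree_edges_def less_Suc_eq by blast
    ultimately show ?case using Suc by (simp add: stepF)
  qed
  ultimately show thesis
    using that[of P Q N] vertsF by (simp add: Phi_def flip: s_def)
qed

lemma Phi_complete_exploration:
  assumes G: "graph_on k G" "m \<in> verts G" and f: "f \<in> multiparking G m"
  obtains P Q N where "complete_exploration G m \<tau> P Q N" "parking_exploration G m \<tau> P Q N f"
    "edges (Phi G m \<tau> f) = exploration.tree_edges \<tau> Q N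
        (\<lambda>j w. nat (f w - int (exploration.load G \<tau> Q j w))) (card (verts G))"
    "verts (Phi G m \<tau> f) = verts G"
proof -
  have "finite (verts G)" using G by (simp add: graph_on_def)
  then obtain P Q N where PQN: "parking_exploration G m \<tau> P Q N f"
    "edges (Phi G m \<tau> f) = exploration.tree_edges \<tau> Q N
        (\<lambda>j w. nat (f w - int (exploration.load G \<tau> Q j w))) (card (verts G))"
    "verts (Phi G m \<tau> f) = P (card (verts G)) \<union> Q (card (verts G))"
    by (rule Phi_parking_exploration[OF _ G(2)])
  interpret parking_exploration G m \<tau> P Q N f by fact
  interpret complete_exploration G m \<tau> P Q N
    by unfold_locales (use restart_at_minus_one[OF G(1) f] in fastforce)
  show thesis
    using that PQN P_final Q_final complete_exploration_axioms by simp
qed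

section \<open>The map is well defined and injective\<close>

lemma Phi_in_spanning_forests:
  assumes G: "graph_on k G" "m \<in> verts G" and f: "f \<in> multiparking G m"
  shows "Phi G m \<tau> f \<in> spanning_forests G m"
proof -
  let ?F = "Phi G m \<tau> f"
  obtain P Q N where "complete_exploration G m \<tau> P Q N" "parking_exploration G m \<tau> P Q N f"
    and E: "edges ?F = exploration.tree_edges \<tau> Q N
        (\<lambda>j w. nat (f w - int (exploration.load G \<tau> Q j w))) (card (verts G))"
    and V: "verts ?F = verts G"
    by (rule Phi_complete_exploration[OF G f])
  then interpret complete_exploration G m \<tau> P Q N + parking_exploration G m \<tau> P Q N f
    by simp_all
  have "edges ?F \<subseteq> edges G"
  proof
    fix e assume "e \<in> edges ?F"
    then obtain j w where j: "j < n" "w \<in> N j" "e = ({w, visit j}, nat (f w - int (load j w)))"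
      unfolding E tree_edges_def by blast
    then have "int (load j w) \<le> f w" "f w < int (load j w) + int (mu G w (visit j))" "w \<in> V"
      using N_parking[of j] by (auto simp: load_Suc)
    moreover have "visit j \<in> V" using j visit_image by blast
    ultimately show "e \<in> edges G"
      using edge_colour_iff[OF G(1), of w "visit j"] j(3) by simp
  qed
  moreover have "\<exists>j\<in>C. m \<le> j" if "C \<in> components ?F" for C
    using that tree_reaches_root[OF E V] V by (force simp: components_def component_of_def)
  ultimately show ?thesis
    using tree_acyclic[OF E V] V by (simp add: spanning_forests_def)
qed

lemma Phi_inj:
  assumes G: "graph_on k G" "m \<in> verts G"
    and f: "f \<in> multiparking G m" and g: "g \<in> multiparking G m"
    and eq: "Phi G m \<tau> f = Phi G m \<tau> g"
  shows "f = g"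
proof -
  let ?F = "Phi G m \<tau> f"
  obtain P Q N where "complete_exploration G m \<tau> P Q N" "parking_exploration G m \<tau> P Q N f"
    and Ef: "edges (Phi G m \<tau> f) = exploration.tree_edges \<tau> Q N
        (\<lambda>j w. nat (f w - int (exploration.load G \<tau> Q j w))) (card (verts G))"
    and "verts (Phi G m \<tau> f) = verts G"
    by (rule Phi_complete_exploration[OF G f])
  then interpret A: complete_exploration G m \<tau> P Q N + A: parking_exploration G m \<tau> P Q N f
    by simp_all
  obtain P' Q' N' where "complete_exploration G m \<tau> P' Q' N'" "parking_exploration G m \<tau> P' Q' N' g"
    and Eg: "edges (Phi G m \<tau> g) = exploration.tree_edges \<tau> Q' N'
        (\<lambda>j w. nat (g w - int (exploration.load G \<tau> Q' j w))) (card (verts G))"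
    and "verts (Phi G m \<tau> g) = verts G"
    by (rule Phi_complete_exploration[OF G g])
  then interpret B: complete_exploration G m \<tau> P' Q' N' + B: parking_exploration G m \<tau> P' Q' N' g
    by simp_all
  note Eg = Eg[folded eq]
  let ?n = "card (verts G)"
  \<comment> \<open>both searches are the search that follows the common output\<close>
  have agree: "(\<forall>i\<le>?n. P i = P' i \<and> Q i = Q' i) \<and> (\<forall>i<?n. N i = N' i)"
  proof (rule explorations_agree)
    fix i assume i: "i < ?n" and "\<And>j. j \<le> i \<Longrightarrow> P j = P' j \<and> Q j = Q' j"
    then have PQ: "P i = P' i" "Q i = Q' i" by auto
    have "w \<in> N i \<longleftrightarrow> w \<in> N' i" if w: "w \<in> verts G - (P i \<union> Q i)" for w
    proof -
      have "w \<in> N i \<longleftrightarrow> (\<exists>c. ({w, A.visit i}, c) \<in> edges ?F)"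
        unfolding Ef using A.tree_edge_to_undiscovered[OF i w] by simp
      also have "\<dots> \<longleftrightarrow> w \<in> N' i"
        unfolding Eg using B.tree_edge_to_undiscovered[OF i] w PQ
        by (simp add: A.visit_def B.visit_def)
      finally show ?thesis .
    qed
    then show "N i = N' i" using A.N_sub[OF i] B.N_sub[OF i] PQ by blast
  qed unfold_locales
  have visit: "A.visit i = B.visit i" if "i < ?n" for i
    using agree that by (simp add: A.visit_def B.visit_def)
  then have load: "A.load i w = B.load i w" if "i \<le> ?n" for i w
    using that by (simp add: A.load_def B.load_def)
  have "f w = g w" if w: "w \<in> verts G" for w
  proof (cases "\<exists>i<?n. w \<in> N i")
    case True
    then obtain i where i: "i < ?n" "w \<in> N i" by blast
    have wi: "w \<in> verts G - (P i \<union> Q i)" "w \<in> verts G - (P' i \<union> Q' i)"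
      using A.N_sub i agree by auto
    have "({w, A.visit i}, nat (f w - int (A.load i w))) \<in> edges ?F"
      unfolding Ef using A.tree_edge_to_undiscovered[OF i(1) wi(1)] i by simp
    then have "nat (f w - int (A.load i w)) = nat (g w - int (A.load i w))"
      unfolding Eg using B.tree_edge_to_undiscovered[OF i(1) wi(2)] visit load i by simp
    moreover have "w \<in> N' i" using agree i by auto
    ultimately show ?thesis
      using A.N_parking[OF i(1)] B.N_parking[OF i(1)] i load[of i w] by auto
  next
    case False
    then obtain j where j: "j < ?n" "A.visit j = w" "A.stalled j" "alpha (verts G - P j) m = Some w"
      using A.child_or_root[OF w] by blast
    have "B.stalled j"
      using j(1,3) agree unfolding A.stalled_def B.stalled_def by simp
    moreover have "P j \<noteq> verts G" using j(4) by (auto simp: alpha_eq_Some_iff)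
    ultimately show ?thesis
      using A.restart_at_minus_one[OF G(1) f j(3)] B.restart_at_minus_one[OF G(1) g, of j] j agree
      by auto
  qed
  moreover have "f \<in> extensional (verts G)" "g \<in> extensional (verts G)"
    using f g by (auto simp: multiparking_def PiE_def)
  ultimately show ?thesis by (rule extensionalityI[rotated 2])
qed

section \<open>Explorations directed by a forest\<close>

text \<open>
  At a stalled time no edge of \<open>F\<close> leads from a visited vertex to an unvisited one, since its end would
  have been discovered. Thus the component of any unvisited vertex is unvisited, and it supplies a root.
\<close>

lemma forest_exploration_exists:
  assumes G: "graph_on k G" "m \<in> verts G" and F: "F \<in> spanning_forests G m"
  obtains P Q N where "complete_exploration G m \<tau> P Q N"
    "\<And>i. i < card (verts G) \<Longrightarrow>
      N i = {w \<in> verts G - (P i \<union> Q i). adjacent F (exploration.visit \<tau> Q i) w}"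
proof -
  have "finite (verts G)" using G by (simp add: graph_on_def)
  then obtain P Q where PQ: "exploration G m \<tau> P Q
      (\<lambda>i. {w \<in> verts G - (P i \<union> Q i). adjacent F (arg_min_on \<tau> (Q i)) w})"
    using exploration_exists[of G m "\<lambda>p q. {w \<in> verts G - (p \<union> q). adjacent F (arg_min_on \<tau> q) w}" \<tau>]
      G(2) by auto
  define N where "N i = {w \<in> verts G - (P i \<union> Q i). adjacent F (arg_min_on \<tau> (Q i)) w}" for i
  interpret exploration G m \<tau> P Q N using PQ by (simp add: N_def[abs_def])
  have N: "N i = {w \<in> verts G - (P i \<union> Q i). adjacent F (visit i) w}" for i
    by (simp add: N_def visit_def)
  have FV: "verts F = V" and comp: "\<And>C. C \<in> components F \<Longrightarrow> \<exists>j\<in>C. m \<le> j"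
    using F by (auto simp: spanning_forests_def)
  have "complete_exploration G m \<tau> P Q N"
  proof unfold_locales
    fix j assume j: "stalled j" "j \<le> n" "P j \<noteq> V"
    obtain u where u: "u \<in> V - P j" using P_neq_V_imp_Diff_nonempty j by blast
    have closed: "y \<notin> P j" if x: "x \<in> V - P j" and adj: "adjacent F x y" for x y
    proof
      assume "y \<in> P j"
      then obtain i where i: "i < j" "y = visit i" using P_image[OF j(2)] by auto
      have "x \<notin> P i \<union> Q i \<union> N i" using x i j by (auto simp: stalled_def)
      then show False using x adj i by (auto simp: N adjacent_def insert_commute)
    qed
    have edge_V: "y \<in> V" if "adjacent F x y" for x y
      using that F G by (force simp: adjacent_def spanning_forests_def graph_on_def doubleton_eq_iff)
    have reach: "y \<in> V - P j" if "(adjacent F)\<^sup>*\<^sup>* u y" for y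
      using that by (induction rule: rtranclp_induct) (use u closed edge_V in auto)
    have "component_of F u \<in> components F" using u FV by (simp add: components_def)
    then obtain r where "r \<in> V - P j" "m \<le> r"
      using comp reach by (force simp: component_of_def)
    then show "alpha (V - P j) m \<noteq> None" unfolding alpha_eq_None_iff using leD by blast
  qed
  then show thesis using that N by blast
qed

text \<open>
  Consider an edge of \<open>F\<close> at the time when the first of its ends is visited. If the other end is waiting
  in the queue, the edges found so far give a detour; otherwise the other end is discovered now, and a
  second edge to it would be parallel to the one chosen.
\<close>

lemma (in complete_exploration) forest_eq_tree_edges:
  assumes acyc: "acyclic_graph F" and FV: "verts F = V"
    and ends: "\<And>e. e \<in> edges F \<Longrightarrow> \<exists>i\<in>V. \<exists>j\<in>V. fst e = {i, j}"
    and N: "\<And>i. i < n \<Longrightarrow> N i = {w \<in> V - (P i \<union> Q i). adjacent F (visit i) w}"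
    and col: "\<And>i w. i < n \<Longrightarrow> w \<in> N i \<Longrightarrow> ({w, visit i}, col i w) \<in> edges F"
  shows "edges F = tree_edges col n"
proof
  show sub: "tree_edges col n \<subseteq> edges F"
    using col by (auto simp: tree_edges_def)
  have endsF: "fst e \<subseteq> verts F" if "e \<in> edges F" for e using ends[OF that] FV by auto
  note no_detour = acyclic_no_detour[OF acyc _ _ endsF]
  have main: "e \<in> tree_edges col n"
    if e: "e \<in> edges F" "fst e = {visit i, visit j}" and ij: "i < j" "j < n" for e i j
  proof (cases "visit j \<in> Q i")
    case True
    let ?T = "tree_edges col i"
    have "e \<notin> ?T"
    proof
      assume "e \<in> ?T"
      then obtain l where "l < i" "visit l \<in> fst e" by (auto simp: tree_edges_def)
      then show False using e(2) visit_eq_iff[of l i] visit_eq_iff[of l j] ij by auto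
    qed
    then have "?T \<subseteq> edges F - {e}"
      using sub ij unfolding tree_edges_def by fastforce
    then show ?thesis
      using no_detour[OF e] tree_connects_queue[of i "visit i" "visit j"] True visit_in_Q[of i] ij
      by auto
  next
    case False
    have i: "i < n" using ij by simp
    have vj: "visit j \<in> N i"
      using N[OF i] False visit_in_P_iff[of j i] ij e visit_image by (auto simp: adjacent_def)
    define e' where "e' = ({visit j, visit i}, col i (visit j))"
    have "e = e'"
    proof (rule ccontr)
      assume "e \<noteq> e'"
      then have "{e'} \<subseteq> edges F - {e}" using col[OF i vj] by (simp add: e'_def)
      moreover have "(\<lambda>x y. \<exists>e\<in>{e'}. fst e = {x, y})\<^sup>*\<^sup>* (visit i) (visit j)"
        by (rule r_into_rtranclp) (simp add: e'_def insert_commute)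
      ultimately show False using no_detour[OF e] by blast
    qed
    then show ?thesis using i vj by (auto simp: e'_def tree_edges_def)
  qed
  show "edges F \<subseteq> tree_edges col n"
  proof
    fix e assume e: "e \<in> edges F"
    then obtain a b where ab: "a \<in> V" "b \<in> V" "fst e = {a, b}" using ends by blast
    obtain i where "i < n" "a = visit i" using ab(1) visit_image by auto
    moreover obtain j where "j < n" "b = visit j" using ab(2) visit_image by auto
    ultimately have ij: "i < n" "j < n" "fst e = {visit i, visit j}" using ab(3) by auto
    consider "i = j" | "i < j" | "j < i" by linarith
    then show "e \<in> tree_edges col n"
    proof cases
      case 1
      then show ?thesis using no_detour[OF e ij(3), of "{}"] by simp
    next
      case 2
      then show ?thesis using main[OF e ij(3)] ij by blast
    next
      case 3
      moreover have "fst e = {visit j, visit i}" using ij(3) by (simp add: insert_commute)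
      ultimately show ?thesis using main[OF e] ij by blast
    qed
  qed
qed

lemma Phi_surj:
  assumes G: "graph_on k G" "m \<in> verts G" and F: "F \<in> spanning_forests G m"
  shows "\<exists>f\<in>multiparking G m. Phi G m \<tau> f = F"
proof -
  let ?n = "card (verts G)"
  obtain P Q N where "complete_exploration G m \<tau> P Q N"
    and N: "\<And>i. i < ?n \<Longrightarrow>
      N i = {w \<in> verts G - (P i \<union> Q i). adjacent F (exploration.visit \<tau> Q i) w}"
    by (rule forest_exploration_exists[OF G F, where \<tau> = \<tau>]) (rule that)
  then interpret A: complete_exploration G m \<tau> P Q N by simp
  have F': "verts F = verts G" "edges F \<subseteq> edges G" "acyclic_graph F"
    using F by (auto simp: spanning_forests_def)
  have ends: "\<exists>i\<in>verts G. \<exists>j\<in>verts G. fst e = {i, j}" if "e \<in> edges F" for e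
    using that F'(2) G(1) unfolding graph_on_def by blast
  define col where "col i w = (SOME c. ({w, A.visit i}, c) \<in> edges F)" for i w
  have col: "({w, A.visit i}, col i w) \<in> edges F" if "i < ?n" "w \<in> N i" for i w
  proof -
    have "\<exists>c. ({w, A.visit i}, c) \<in> edges F"
      using that N by (auto simp: adjacent_def insert_commute)
    then show ?thesis unfolding col_def by (rule someI_ex)
  qed
  have EF: "edges F = A.tree_edges col ?n"
    using A.forest_eq_tree_edges[OF F'(3,1) ends N col] .
  define parent where "parent w = (SOME i. i < ?n \<and> w \<in> N i)" for w
  have parent: "parent w = i" if "i < ?n" "w \<in> N i" for i w
    unfolding parent_def using that A.N_disjoint by (intro some_equality) auto
  define f :: "nat \<Rightarrow> int" where "f = (\<lambda>w\<in>verts G.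
    if \<exists>i<?n. w \<in> N i then int (A.load (parent w) w + col (parent w) w) else -1)"
  have f_child: "f w = int (A.load i w + col i w)" if "i < ?n" "w \<in> N i" for i w
    using that parent[OF that] A.N_sub[OF that(1)] by (auto simp: f_def)
  have other: "f w = -1" if "w \<in> verts G" "\<And>i. i < ?n \<Longrightarrow> w \<notin> N i" for w
    using that by (auto simp: f_def)
  have child: "int (A.load i w) \<le> f w \<and> f w < int (A.load (Suc i) w)"
    if i: "i < ?n" "w \<in> N i" for i w
  proof -
    have "w \<in> verts G" "A.visit i \<in> verts G" using i A.N_sub A.visit_image by blast+
    then have "col i w < mu G w (A.visit i)"
      using col[OF i] F'(2) edge_colour_iff[OF G(1)] by blast
    then show ?thesis using f_child[OF i] by (simp add: A.load_Suc)
  qed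
  have "f \<in> verts G \<rightarrow>\<^sub>E {-1..}" by (simp add: f_def)
  with G(1) have f_mp: "f \<in> multiparking G m"
    using child other by (rule A.children_imp_multiparking)
  have "N i = {w \<in> verts G - (P i \<union> Q i). int (A.load i w) \<le> f w \<and> f w < int (A.load (Suc i) w)}"
    if "i < ?n" for i
    using child other that by (rule A.children_satisfy_parking_rule)
  then interpret A: parking_exploration G m \<tau> P Q N f
    by unfold_locales
  obtain P' Q' N' where "complete_exploration G m \<tau> P' Q' N'"
    and B: "parking_exploration G m \<tau> P' Q' N' f"
    and E: "edges (Phi G m \<tau> f) = exploration.tree_edges \<tau> Q' N'
        (\<lambda>j w. nat (f w - int (exploration.load G \<tau> Q' j w))) ?n"
    and V: "verts (Phi G m \<tau> f) = verts G"
    by (rule Phi_complete_exploration[OF G f_mp])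
  interpret B: parking_exploration G m \<tau> P' Q' N' f by fact
  have agree: "(\<forall>i\<le>?n. P i = P' i \<and> Q i = Q' i) \<and> (\<forall>i<?n. N i = N' i)"
    by (rule parking_explorations_agree[OF A.parking_exploration_axioms B])
  have visit: "A.visit i = B.visit i" if "i < ?n" for i
    using agree that by (simp add: A.visit_def B.visit_def)
  then have load: "A.load i w = B.load i w" if "i \<le> ?n" for i w
    using that by (simp add: A.load_def B.load_def)
  have colour: "nat (f w - int (B.load j w)) = col j w" if "j < ?n" "w \<in> N j" for j w
    using f_child[OF that] load[of j w] that by simp
  have "edges (Phi G m \<tau> f) = edges F"
    unfolding E EF A.tree_edges_def B.tree_edges_def
  proof (intro Collect_cong ex_cong1)
    fix e j w
    show "e = ({w, B.visit j}, nat (f w - int (B.load j w))) \<and> j < ?n \<and> w \<in> N' j \<longleftrightarrow>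
        e = ({w, A.visit j}, col j w) \<and> j < ?n \<and> w \<in> N j"
      using agree visit[of j] colour[of j w] by (cases "j < ?n \<and> w \<in> N j") auto
  qed
  then have "Phi G m \<tau> f = F" using V F'(1) by simp
  then show ?thesis using f_mp by blast
qed

theorem theorem2p1:
  fixes n m :: nat and G :: cgraph and \<tau> :: "nat \<Rightarrow> nat"
  assumes "graph_on n G"
    and "connected_graph G"
    and "m \<in> {1..n}"
    and "\<tau> permutes {1..n}"
  shows "bij_betw (Phi G m \<tau>) (multiparking G m) (spanning_forests G m)"
proof -
  have m: "m \<in> verts G" using assms(1,3) by (simp add: graph_on_def)
  show ?thesis
    unfolding bij_betw_def
  proof
    show "inj_on (Phi G m \<tau>) (multiparking G m)"
      using Phi_inj[OF assms(1) m] by (rule inj_onI)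
    show "Phi G m \<tau> ` multiparking G m = spanning_forests G m"
    proof (intro subset_antisym image_subsetI subsetI)
      fix F assume "F \<in> spanning_forests G m"
      from Phi_surj[OF assms(1) m this, of \<tau>] show "F \<in> Phi G m \<tau> ` multiparking G m" by blast
    qed (rule Phi_in_spanning_forests[OF assms(1) m])
  qed
qed

end
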